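(* Let $R$ be a Noetherian $F$-finite strongly $F$-regular domain of prime characteristic $p>0$, let $J$ be an ideal of $R$, and let $f\in\sqrt J$. Then $$c^J(f)=\inf\left\{\frac{a}{p^e}\,\middle|\, f^{a/p^e}\in JR^+\right\}=\sup\left\{\frac{a}{p^e}\,\middle|\, f^{a/p^e}\notin JR^+\right\},$$ where $a$ and $e$ range over the nonnegative integers.
   Context: For $f\in\sqrt J$, the $F$-threshold of $f$ with respect to $J$ is $c^J(f)=\lim_{e\to\infty}\nu_e^J(f)/p^e$, where $\nu^J_e(f)=\max\{n\in\mathbb Z_{\ge 0}\mid f^n\notin J^{[p^e]}\}$ and $J^{[p^e]}$ is the ideal generated by the $p^e$-th powers of elements of $J$ (the limit is known to exist for $F$-finite rings). In the degenerate case $J=R$, the maximum and the supremum of the empty set are taken to be $0$. $R^+$ is the absolute integral closure of $R$, i.e. the integral closure of $R$ in an algebraic closure of its fraction field; $f^{1/p^e}$ denotes the unique $p^e$-th root of $f$ in $R^+$ and $f^{a/p^e}=(f^{1/p^e})^a$. Strongly $F$-regular means: for every nonzero $d\in R$ there is $e>0$ and an $R$-linear map $R^{1/p^e}\to R$ sending $d^{1/p^e}$ to $1$. *)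

theory Defs
  imports Complex_Main "HOL-Computational_Algebra.Computational_Algebra"
    "HOL-Algebra.Algebraic_Closure_Type"
begin

text \<open>
  The domain \<open>R\<close> is a type of class \<^class>\<open>idom\<close>. All roots of elements of \<open>R\<close> live in the
  algebraic closure \<open>'a fract alg_closure\<close> of its fraction field.
\<close>

section \<open>Ideals and finiteness conditions\<close>

definition ring_ideal :: "'a::comm_ring_1 set \<Rightarrow> bool" where
  "ring_ideal I \<longleftrightarrow> module.subspace (*) I"

definition ideal_gen :: "'a::comm_ring_1 set \<Rightarrow> 'a set" where
  "ideal_gen S = module.span (*) S"

lemma module_ring_mult: "Modules.module ((*) :: 'a::comm_ring_1 \<Rightarrow> 'a \<Rightarrow> 'a)"
  by unfold_locales (auto simp: algebra_simps)

definition noetherian :: "'a::comm_ring_1 itself \<Rightarrow> bool" where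
  "noetherian _ \<longleftrightarrow>
     (\<forall>I :: 'a set. ring_ideal I \<longrightarrow> (\<exists>B. finite B \<and> I = ideal_gen B))"

definition ideal_radical :: "'a::comm_ring_1 set \<Rightarrow> 'a set" where
  "ideal_radical J = {f. \<exists>n>0. f ^ n \<in> J}"

text \<open>
  The scalar action \<open>r \<cdot> x = r\<^sup>p x\<close> is the module structure of \<open>R\<close> over itself by restriction
  of scalars along the Frobenius map.
\<close>

lemma module_frobenius:
  assumes "prime p" "CHAR('a) = p"
  shows "Modules.module (\<lambda>r x :: 'a::comm_ring_1. r ^ p * x)"
  using assms
  by unfold_locales (auto simp: algebra_simps freshmans_dream power_mult_distrib)

definition F_finite :: "nat \<Rightarrow> 'a::comm_ring_1 itself \<Rightarrow> bool" where
  "F_finite p _ \<longleftrightarrow>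
     (\<exists>B :: 'a set. finite B \<and> module.span (\<lambda>r x. r ^ p * x) B = UNIV)"


section \<open>The absolute integral closure\<close>

definition emb :: "'a::idom \<Rightarrow> 'a fract alg_closure" where
  "emb r = to_ac (to_fract r)"

definition abs_int_closure :: "'a::idom fract alg_closure set" where
  "abs_int_closure =
     {x. \<exists>q :: 'a poly. Polynomial.lead_coeff q = 1 \<and> poly (map_poly emb q) x = 0}"

text \<open>The expansion \<open>J R\<^sup>+\<close>: all \<open>R\<^sup>+\<close>-linear combinations of elements of \<open>J\<close>.\<close>

definition ideal_expansion :: "'a::idom set \<Rightarrow> 'a fract alg_closure set" where
  "ideal_expansion J =
     {(\<Sum>j\<in>T. s j * emb j) | T s. finite T \<and> T \<subseteq> J \<and> s ` T \<subseteq> abs_int_closure}"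

text \<open>\<open>pe_root p e r\<close> is \<open>r\<^bsup>1/p^e\<^esup>\<close>; it is well defined when \<open>R\<close> has prime characteristic \<open>p\<close>.\<close>

definition pe_root :: "nat \<Rightarrow> nat \<Rightarrow> 'a::idom \<Rightarrow> 'a fract alg_closure" where
  "pe_root p e r = (THE x. x \<in> abs_int_closure \<and> x ^ (p ^ e) = emb r)"


section \<open>Strong F-regularity\<close>

text \<open>
  The ring \<open>R\<^bsup>1/p^e\<^esup>\<close> is the range of \<^term>\<open>pe_root p e\<close>; only the values of \<open>\<phi>\<close> on this range
  are relevant.
\<close>

definition strongly_F_regular :: "nat \<Rightarrow> 'a::idom itself \<Rightarrow> bool" where
  "strongly_F_regular p _ \<longleftrightarrow>
     (\<forall>d :: 'a. d \<noteq> 0 \<longrightarrow>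
       (\<exists>e>0. \<exists>\<phi> :: 'a fract alg_closure \<Rightarrow> 'a.
          (\<forall>x\<in>range (pe_root p e). \<forall>y\<in>range (pe_root p e). \<phi> (x + y) = \<phi> x + \<phi> y) \<and>
          (\<forall>r. \<forall>x\<in>range (pe_root p e). \<phi> (emb r * x) = r * \<phi> x) \<and>
          \<phi> (pe_root p e d) = 1))"


section \<open>F-thresholds\<close>

definition frobenius_power :: "nat \<Rightarrow> nat \<Rightarrow> 'a::comm_ring_1 set \<Rightarrow> 'a set" where
  "frobenius_power p e J = ideal_gen ((\<lambda>x. x ^ (p ^ e)) ` J)"

text \<open>
  The maximum and the supremum of the empty set are \<open>0\<close> by convention (both occur for \<open>J = R\<close>);
  \<^term>\<open>Max {}\<close> and \<^term>\<open>Sup {} :: real\<close> have no specified value.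
\<close>

definition nu :: "nat \<Rightarrow> 'a::comm_ring_1 set \<Rightarrow> 'a \<Rightarrow> nat \<Rightarrow> nat" where
  "nu p J f e =
     (let N = {n. f ^ n \<notin> frobenius_power p e J} in if N = {} then 0 else Max N)"

definition F_threshold :: "nat \<Rightarrow> 'a::comm_ring_1 set \<Rightarrow> 'a \<Rightarrow> real" where
  "F_threshold p J f = lim (\<lambda>e. real (nu p J f e) / real (p ^ e))"

definition Sup0 :: "real set \<Rightarrow> real" where
  "Sup0 A = (if A = {} then 0 else Sup A)"

end

theory Submission
  imports Defs
begin

text \<open>
  Write \<open>q = p^e\<close>. The heart of the matter is the equivalence
  \<open>f\<^bsup>a/q\<^esup> \<in> J R\<^sup>+ \<longleftrightarrow> f\<^sup>a \<in> J\<^bsup>[q]\<^esup>\<close> (lemma \<open>root_in_expansion_iff\<close>). It says that \<open>\<nu>\<^sub>e\<close> is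
  the largest \<open>a\<close> with \<open>f\<^bsup>a/q\<^esup> \<notin> J R\<^sup>+\<close>, so that for \<open>J \<noteq> R\<close> the numbers \<open>\<nu>\<^sub>e/q\<close> and
  \<open>(\<nu>\<^sub>e + 1)/q\<close> lie on the two sides of the cut that \<open>J R\<^sup>+\<close> makes in the exponents. Since
  the gap is \<open>1/q\<close>, the infimum of the upper side, the supremum of the lower side and the
  limit of \<open>\<nu>\<^sub>e/q\<close> coincide; in particular the limit exists. For \<open>J = R\<close> all three are \<open>0\<close>.

  From right to left one takes \<open>q\<close>-th roots of the coefficients, Frobenius being injective
  and additive. From left to right, taking \<open>q\<close>-th powers gives \<open>f\<^sup>a \<in> J\<^bsup>[q]\<^esup> R\<^sup>+ \<inter> R\<close>, and two
  facts finish the argument.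

  \<^item> For every ideal \<open>I\<close>, the ideal \<open>I R\<^sup>+ \<inter> R\<close> lies in the tight closure of \<open>I\<close>. Let
  \<open>z = \<Sum> s\<^sub>j j\<close> with \<open>s\<^sub>j \<in> R\<^sup>+\<close> and \<open>j \<in> I\<close>, and choose a linear functional \<open>L\<close> from the
  algebraic closure to the fraction field with \<open>L 1 = 1\<close>. As \<open>s\<^sub>j\<close> is integral over \<open>R\<close>, the
  values of \<open>L\<close> on all powers of the \<open>s\<^sub>j\<close> have a common denominator \<open>d\<close>. Applying \<open>d L\<close> to
  \<open>z\<^sup>Q = \<Sum> s\<^sub>j\<^sup>Q j\<^sup>Q\<close> gives \<open>d z\<^sup>Q \<in> I\<^bsup>[Q]\<^esup>\<close> for all powers \<open>Q\<close> of \<open>p\<close>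
  (lemma \<open>expansion_root_almost_in_frobenius_powers\<close>).

  \<^item> Every ideal \<open>I\<close> of a strongly \<open>F\<close>-regular ring is tightly closed: if \<open>\<phi>\<close> sends \<open>d\<^bsup>1/Q\<^esup>\<close> to \<open>1\<close>,
  then applying \<open>\<phi>\<close> to \<open>d\<^bsup>1/Q\<^esup> z \<in> I R\<^bsup>1/Q\<^esup>\<close> gives \<open>z \<in> I\<close>
  (lemma \<open>strongly_F_regular_tightly_closed\<close>).
\<close>


section \<open>Ideals and Frobenius powers\<close>

lemma ring_ideal_iff:
  "ring_ideal I \<longleftrightarrow> 0 \<in> I \<and> (\<forall>x\<in>I. \<forall>y\<in>I. x + y \<in> I) \<and> (\<forall>c. \<forall>x\<in>I. c * x \<in> I)"
  unfolding ring_ideal_def module.subspace_def[OF module_ring_mult] by blast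

lemma ring_ideal_ideal_gen: "ring_ideal (ideal_gen S)"
  unfolding ring_ideal_def ideal_gen_def by (rule module.subspace_span[OF module_ring_mult])

lemma ring_ideal_frobenius_power: "ring_ideal (frobenius_power p e J)"
  unfolding frobenius_power_def by (rule ring_ideal_ideal_gen)

lemma power_in_frobenius_power: "x \<in> J \<Longrightarrow> x ^ (p ^ e) \<in> frobenius_power p e J"
  unfolding frobenius_power_def ideal_gen_def
  by (rule module.span_base[OF module_ring_mult]) auto

lemma frobenius_power_iterate:
  "frobenius_power p (k + e) J \<subseteq> frobenius_power p e (frobenius_power p k J)"
proof -
  have "x ^ p ^ (k + e) \<in> frobenius_power p e (frobenius_power p k J)" if "x \<in> J" for x
    using power_in_frobenius_power[OF power_in_frobenius_power[OF that, of p k], of p e]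
    by (simp add: power_mult power_add)
  then have "(\<lambda>x. x ^ p ^ (k + e)) ` J \<subseteq> frobenius_power p e (frobenius_power p k J)"
    by blast
  from module.span_minimal[OF module_ring_mult this] show ?thesis
    using ring_ideal_frobenius_power[of p e "frobenius_power p k J"]
    by (simp add: frobenius_power_def[of p "k + e"] ideal_gen_def ring_ideal_def)
qed

lemma power_mono_in_ideal:
  assumes "ring_ideal I" "f ^ m \<in> I" "m \<le> n"
  shows "f ^ n \<in> I"
proof -
  have "f ^ n = f ^ (n - m) * f ^ m" using assms(3) by (simp flip: power_add)
  with assms show ?thesis by (auto simp: ring_ideal_iff)
qed

lemma frobenius_power_explicit:
  assumes "y \<in> frobenius_power p e J"
  obtains T r where "finite T" "T \<subseteq> J" "y = (\<Sum>j\<in>T. r j * j ^ (p ^ e))"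
proof -
  from assms obtain U r where U: "finite U" "U \<subseteq> (\<lambda>x. x ^ (p ^ e)) ` J"
    "y = (\<Sum>a\<in>U. r a * a)"
    unfolding frobenius_power_def ideal_gen_def module.span_explicit[OF module_ring_mult] by auto
  then obtain T where T: "T \<subseteq> J" "inj_on (\<lambda>x. x ^ (p ^ e)) T" "U = (\<lambda>x. x ^ (p ^ e)) ` T"
    using subset_image_inj[of U "\<lambda>x. x ^ (p ^ e)" J] by metis
  show ?thesis
  proof (rule that)
    show "finite T" using U(1) T finite_imageD by blast
    show "y = (\<Sum>j\<in>T. r (j ^ (p ^ e)) * j ^ (p ^ e))"
      using U(3) T by (simp add: sum.reindex)
  qed (fact T)
qed


section \<open>Roots in the absolute integral closure\<close>

lemma emb_0 [simp]: "emb 0 = 0" and emb_1 [simp]: "emb 1 = 1"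
  and emb_add [simp]: "emb (x + y) = emb x + emb y"
  and emb_diff [simp]: "emb (x - y) = emb x - emb y"
  and emb_mult [simp]: "emb (x * y) = emb x * emb y"
  and emb_eq_iff [simp]: "emb x = emb y \<longleftrightarrow> x = y"
  by (simp_all add: emb_def)

lemma emb_power [simp]: "emb (x ^ n) = emb x ^ n"
  by (induction n) auto

lemma emb_sum [simp]: "emb (sum g A) = (\<Sum>x\<in>A. emb (g x))"
  by (induction A rule: infinite_finite_induct) auto

lemma to_fract_of_nat: "to_fract (of_nat n) = of_nat n"
  by (induction n) auto

lemma CHAR_fract [simp]: "CHAR('a::idom fract) = CHAR('a)"
proof (rule CHAR_eqI)
  show "of_nat CHAR('a) = (0 :: 'a fract)"
    by (metis of_nat_CHAR to_fract_0 to_fract_of_nat)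
  show "CHAR('a) dvd n" if "of_nat n = (0 :: 'a fract)" for n
    using that by (metis of_nat_eq_0_iff_char_dvd to_fract_eq_0_iff to_fract_of_nat)
qed

lemma frobenius_injective:
  fixes x y :: "'a::idom"
  assumes "prime p" "CHAR('a) = p" "x ^ (p ^ e) = y ^ (p ^ e)"
  shows "x = y"
proof -
  have "(y + (x - y)) ^ (p ^ e) = y ^ (p ^ e) + (x - y) ^ (p ^ e)"
    using assms(1,2) by (intro freshmans_dream'[where n = e]) auto
  with assms(3) have "(x - y) ^ (p ^ e) = 0" by simp
  then show ?thesis by simp
qed

lemma root_in_abs_int_closure:
  assumes "n > 0" "x ^ n = emb r"
  shows "x \<in> abs_int_closure"
proof -
  define q where "q = Polynomial.monom 1 n - [:r:]"
  have c: "Polynomial.coeff q i = (if i = n then 1 else if i = 0 then - r else 0)" for i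
    using assms(1) by (auto simp: q_def coeff_pCons split: nat.splits)
  have "Polynomial.degree q = n"
    by (rule antisym[OF degree_le le_degree]) (auto simp: c)
  then have "Polynomial.lead_coeff q = 1" by (simp add: c)
  moreover have "map_poly emb q = Polynomial.monom 1 n - [:emb r:]"
    by (rule poly_eqI) (auto simp: q_def coeff_map_poly coeff_pCons split: nat.splits)
  then have "poly (map_poly emb q) x = 0"
    using assms(2) by (simp add: poly_monom)
  ultimately show ?thesis unfolding abs_int_closure_def by blast
qed

lemma pe_root_eqI:
  fixes r :: "'a::idom"
  assumes p: "prime p" "CHAR('a) = p" and x: "x ^ (p ^ e) = emb r"
  shows "pe_root p e r = x"
  unfolding pe_root_def
proof (rule the_equality)
  show "x \<in> abs_int_closure \<and> x ^ p ^ e = emb r"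
    using x root_in_abs_int_closure[OF _ x] p(1) by (simp add: prime_gt_0_nat)
  show "y = x" if "y \<in> abs_int_closure \<and> y ^ p ^ e = emb r" for y
    using frobenius_injective[of p y e x] that x p by simp
qed

lemma pe_root_power:
  fixes r :: "'a::idom"
  assumes p: "prime p" "CHAR('a) = p"
  shows "pe_root p e r ^ (p ^ e) = emb r"
proof -
  obtain y where "y ^ (p ^ e) = emb r"
    using nth_root_exists[of "p ^ e" "emb r"] p(1) by (auto simp: prime_gt_0_nat)
  with pe_root_eqI[OF p this] show ?thesis by simp
qed

lemma pe_root_in_abs_int_closure:
  fixes r :: "'a::idom"
  assumes p: "prime p" "CHAR('a) = p"
  shows "pe_root p e r \<in> abs_int_closure"
  using root_in_abs_int_closure[OF _ pe_root_power[OF p]] p(1) by (simp add: prime_gt_0_nat)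

lemma pe_root_0:
  assumes p: "prime p" "CHAR('a::idom) = p"
  shows "pe_root p e (0::'a) = 0"
  by (rule pe_root_eqI[OF p]) (use p in \<open>simp add: prime_gt_0_nat\<close>)

lemma pe_root_add:
  fixes r s :: "'a::idom"
  assumes p: "prime p" "CHAR('a) = p"
  shows "pe_root p e (r + s) = pe_root p e r + pe_root p e s"
proof (rule pe_root_eqI[OF p])
  have "(pe_root p e r + pe_root p e s) ^ p ^ e = pe_root p e r ^ p ^ e + pe_root p e s ^ p ^ e"
    by (rule freshmans_dream'[where n = e]) (use p in simp_all)
  then show "(pe_root p e r + pe_root p e s) ^ p ^ e = emb (r + s)"
    by (simp add: pe_root_power[OF p])
qed

lemma pe_root_mult_power:
  fixes r x :: "'a::idom"
  assumes p: "prime p" "CHAR('a) = p"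
  shows "pe_root p e (x ^ (p ^ e) * r) = emb x * pe_root p e r"
  by (rule pe_root_eqI[OF p]) (simp add: power_mult_distrib pe_root_power[OF p])

lemma power_pe_root:
  fixes r :: "'a::idom"
  assumes p: "prime p" "CHAR('a) = p"
  shows "pe_root p e (r ^ a) = pe_root p e r ^ a"
  by (rule pe_root_eqI[OF p]) (metis emb_power mult.commute pe_root_power[OF p] power_mult)

lemma pe_root_rescale:
  fixes r :: "'a::idom"
  assumes p: "prime p" "CHAR('a) = p"
  shows "pe_root p (e + k) r ^ (p ^ k) = pe_root p e r"
  by (rule pe_root_eqI[OF p, symmetric])
     (metis add.commute pe_root_power[OF p] power_add power_mult)

lemma pe_root_in_expansion:
  fixes y :: "'a::idom"
  assumes p: "prime p" "CHAR('a) = p" and y: "y \<in> frobenius_power p e J"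
  shows "pe_root p e y \<in> ideal_expansion J"
proof -
  from y obtain T r where T: "finite T" "T \<subseteq> J" "y = (\<Sum>j\<in>T. r j * j ^ (p ^ e))"
    by (rule frobenius_power_explicit)
  have "pe_root p e y = (\<Sum>j\<in>T. pe_root p e (r j) * emb j)"
  proof (rule pe_root_eqI[OF p])
    have "(\<Sum>j\<in>T. pe_root p e (r j) * emb j) ^ p ^ e =
          (\<Sum>j\<in>T. (pe_root p e (r j) * emb j) ^ p ^ e)"
      by (rule freshmans_dream_sum'[where n = e]) (use p in simp_all)
    then show "(\<Sum>j\<in>T. pe_root p e (r j) * emb j) ^ p ^ e = emb y"
      by (simp add: T(3) power_mult_distrib pe_root_power[OF p])
  qed
  moreover have "(\<lambda>j. pe_root p e (r j)) ` T \<subseteq> abs_int_closure"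
    using pe_root_in_abs_int_closure[OF p] by blast
  ultimately show ?thesis
    using T(1,2) unfolding ideal_expansion_def mem_Collect_eq by (intro exI conjI)
qed


section \<open>The plus closure lies in the tight closure\<close>

lemma linear_retraction_alg_closure:
  obtains L :: "'k::field alg_closure \<Rightarrow> 'k" where
    "\<And>x y. L (x + y) = L x + L y" "\<And>c x. L (to_ac c * x) = c * L x" "L 1 = 1"
proof -
  interpret V: vector_space_pair "\<lambda>c x :: 'k alg_closure. to_ac c * x" "(*) :: 'k \<Rightarrow> 'k \<Rightarrow> 'k"
    by unfold_locales (auto simp: algebra_simps)
  have "V.vs1.independent {1}"
    by (auto simp: V.vs1.dependent_single)
  then obtain L :: "'k alg_closure \<Rightarrow> 'k" where L: "Vector_Spaces.linear (\<lambda>c x. to_ac c * x) (*) L"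
    and "\<forall>x\<in>{1}. L x = 1"
    using V.linear_independent_extend[of "{1}" "\<lambda>_. 1"] by blast
  with V.linear_add[OF L] V.linear_scale[OF L] show ?thesis
    by (intro that[of L]) auto
qed

lemma finite_common_denominator:
  assumes "finite (A :: 'a::idom fract set)"
  shows "\<exists>d. d \<noteq> 0 \<and> (\<forall>x\<in>A. to_fract d * x \<in> range to_fract)"
  using assms
proof (induction A)
  case empty
  show ?case by (intro exI[of _ 1]) auto
next
  case (insert x A)
  then obtain d where d: "d \<noteq> 0" "\<forall>x\<in>A. to_fract d * x \<in> range to_fract" by blast
  obtain a b where x: "x = Fract a b" "b \<noteq> 0" by (cases x) auto
  have "to_fract (d * b) * x = to_fract (d * a)"
    using x by (simp add: Fract_conv_to_fract)
  moreover have "to_fract (d * b) * y \<in> range to_fract" if "y \<in> A" for y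
  proof -
    have "to_fract d * y \<in> range to_fract" using d(2) that ..
    then obtain c where "to_fract d * y = to_fract c" by (rule rangeE)
    moreover have "to_fract (d * b) * y = to_fract b * (to_fract d * y)"
      by (simp add: mult_ac)
    ultimately have "to_fract (d * b) * y = to_fract (b * c)" by simp
    then show ?thesis by (simp only: rangeI)
  qed
  ultimately have "\<forall>y\<in>insert x A. to_fract (d * b) * y \<in> range to_fract"
    by (metis insertE rangeI)
  then show ?case using d(1) x(2) by (intro exI[of _ "d * b"]) auto
qed

text \<open>
  An integral equation of degree \<open>m\<close> writes every power of \<open>s\<close> as an \<open>R\<close>-combination of
  \<open>1, s, ..., s\<^bsup>m-1\<^esup>\<close>, so only finitely many denominators have to be cleared.
\<close>

lemma integral_powers_common_denominator:
  fixes L :: "'a::idom fract alg_closure \<Rightarrow> 'a fract"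
  assumes L: "\<And>x y. L (x + y) = L x + L y" "\<And>c x. L (to_ac c * x) = c * L x"
    and s: "s \<in> abs_int_closure"
  shows "\<exists>d. d \<noteq> 0 \<and> (\<forall>n. to_fract d * L (s ^ n) \<in> range to_fract)"
proof -
  from s obtain q :: "'a poly" where q: "Polynomial.lead_coeff q = 1"
      "poly (map_poly emb q) s = 0"
    unfolding abs_int_closure_def by blast
  define m where "m = Polynomial.degree q"
  have [simp]: "L 0 = 0" using L(2)[of 0 0] by simp
  have Lminus: "L (- x) = - L x" for x
    using L(1)[of x "- x"] by (simp add: eq_neg_iff_add_eq_0 add.commute)
  have Lsum: "L (sum g A) = (\<Sum>i\<in>A. L (g i))" for g and A :: "nat set"
    by (induction A rule: infinite_finite_induct) (auto simp: L(1))
  have "Polynomial.degree (map_poly emb q) = m"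
    unfolding m_def by (rule degree_map_poly) (metis emb_0 emb_eq_iff)
  then have "(\<Sum>i\<le>m. emb (Polynomial.coeff q i) * s ^ i) = 0"
    using q(2) by (simp add: poly_altdef coeff_map_poly)
  then have "s ^ m + (\<Sum>i<m. emb (Polynomial.coeff q i) * s ^ i) = 0"
    using q(1) by (simp flip: lessThan_Suc_atMost add: m_def add.commute)
  then have sm: "s ^ m = - (\<Sum>i<m. emb (Polynomial.coeff q i) * s ^ i)"
    by (simp add: eq_neg_iff_add_eq_0)
  obtain d where d: "d \<noteq> 0" "\<And>n. n < m \<Longrightarrow> to_fract d * L (s ^ n) \<in> range to_fract"
    using finite_common_denominator[of "(\<lambda>n. L (s ^ n)) ` {..<m}"] by auto
  have "to_fract d * L (s ^ n) \<in> range to_fract" for n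
  proof (induction n rule: less_induct)
    case (less n)
    show ?case
    proof (cases "n < m")
      case False
      have "s ^ n = s ^ (n - m) * s ^ m"
        using False by (simp flip: power_add)
      also have "\<dots> = - (\<Sum>i<m. to_ac (to_fract (Polynomial.coeff q i)) * s ^ (i + (n - m)))"
        unfolding sm by (simp add: sum_distrib_left power_add mult_ac emb_def)
      finally have eq: "to_fract d * L (s ^ n) =
          - (\<Sum>i<m. to_fract (Polynomial.coeff q i) * (to_fract d * L (s ^ (i + (n - m)))))"
        by (simp add: Lminus Lsum L(2) sum_distrib_left mult_ac)
      have "to_fract d * L (s ^ (i + (n - m))) \<in> range to_fract" if "i < m" for i
        by (rule less.IH) (use False that in simp)
      then obtain c where c: "\<And>i. i < m \<Longrightarrow> to_fract d * L (s ^ (i + (n - m))) = to_fract (c i)"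
        unfolding image_iff by metis
      have "to_fract d * L (s ^ n) = to_fract (- (\<Sum>i<m. Polynomial.coeff q i * c i))"
        unfolding eq by (simp add: c)
      then show ?thesis by (simp only: rangeI)
    qed (use d in auto)
  qed
  with d(1) show ?thesis by blast
qed

lemma finite_family_common_denominator:
  fixes g :: "'b \<Rightarrow> nat \<Rightarrow> 'a::idom fract"
  assumes "finite T" "\<And>j. j \<in> T \<Longrightarrow> \<exists>d. d \<noteq> 0 \<and> (\<forall>n. to_fract d * g j n \<in> range to_fract)"
  shows "\<exists>d. d \<noteq> 0 \<and> (\<forall>j\<in>T. \<forall>n. to_fract d * g j n \<in> range to_fract)"
proof -
  obtain D where D: "\<And>j. j \<in> T \<Longrightarrow> D j \<noteq> 0"
      "\<And>j n. j \<in> T \<Longrightarrow> to_fract (D j) * g j n \<in> range to_fract"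
    using assms(2) by metis
  have "to_fract (prod D T) * g j n \<in> range to_fract" if "j \<in> T" for j n
  proof -
    from D(2)[OF that, of n] obtain c where "to_fract (D j) * g j n = to_fract c"
      by (rule rangeE)
    moreover have "to_fract (prod D T) * g j n
        = to_fract (prod D (T - {j})) * (to_fract (D j) * g j n)"
      by (simp add: prod.remove[OF assms(1) that])
    ultimately have "to_fract (prod D T) * g j n = to_fract (prod D (T - {j}) * c)" by simp
    then show ?thesis by (simp only: rangeI)
  qed
  moreover have "prod D T \<noteq> 0" using assms(1) D(1) by simp
  ultimately show ?thesis by blast
qed

text \<open>
  With \<open>k = 0\<close> this is the inclusion of the plus closure of \<open>J\<close> in its tight closure. The
  multiplier \<open>d\<close> depends only on the coefficients of \<open>x\<close>, because it serves all of their powers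
  at once; passing to \<open>x\<^bsup>p^k\<^esup>\<close> therefore costs nothing.
\<close>

lemma expansion_root_almost_in_frobenius_powers:
  fixes z :: "'a::idom"
  assumes p: "prime p" "CHAR('a) = p"
    and x: "x \<in> ideal_expansion J" "x ^ (p ^ k) = emb z"
  shows "\<exists>d. d \<noteq> 0 \<and> (\<forall>e. d * z ^ (p ^ e) \<in> frobenius_power p (k + e) J)"
proof -
  from x(1) obtain T s where T: "finite T" "T \<subseteq> J" "s ` T \<subseteq> abs_int_closure"
    and xs: "x = (\<Sum>j\<in>T. s j * emb j)"
    unfolding ideal_expansion_def by blast
  obtain L :: "'a fract alg_closure \<Rightarrow> 'a fract" where
    L: "\<And>x y. L (x + y) = L x + L y" "\<And>c x. L (to_ac c * x) = c * L x" "L 1 = 1"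
    using linear_retraction_alg_closure by blast
  obtain d where d: "d \<noteq> 0" "\<And>j n. j \<in> T \<Longrightarrow> to_fract d * L (s j ^ n) \<in> range to_fract"
    using finite_family_common_denominator[of T "\<lambda>j n. L (s j ^ n)", OF T(1)]
      integral_powers_common_denominator[OF L(1,2)] T(3) by blast
  have [simp]: "L 0 = 0" using L(2)[of 0 0] by simp
  have Lsum: "L (sum g A) = (\<Sum>i\<in>A. L (g i))" for g and A :: "'a set"
    by (induction A rule: infinite_finite_induct) (auto simp: L(1))
  have "d * z ^ (p ^ e) \<in> frobenius_power p (k + e) J" for e
  proof -
    define Q where "Q = p ^ (k + e)"
    obtain c where c: "\<And>j. j \<in> T \<Longrightarrow> to_fract d * L (s j ^ Q) = to_fract (c j)"
      using d(2)[of _ Q] unfolding image_iff by metis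
    have "emb (z ^ (p ^ e)) = x ^ Q"
      by (simp add: Q_def power_add power_mult x(2))
    also have "\<dots> = (\<Sum>j\<in>T. (s j * emb j) ^ Q)"
      unfolding xs Q_def
      by (rule freshmans_dream_sum'[where n = "k + e"]) (use p in simp_all)
    also have "\<dots> = (\<Sum>j\<in>T. to_ac (to_fract (j ^ Q)) * s j ^ Q)"
      by (simp add: power_mult_distrib mult.commute flip: emb_def)
    finally have "L (emb (z ^ (p ^ e))) = (\<Sum>j\<in>T. to_fract (j ^ Q) * L (s j ^ Q))"
      by (simp add: Lsum L(2))
    moreover have "L (emb (z ^ (p ^ e))) = to_fract (z ^ (p ^ e))"
      using L(2)[of "to_fract (z ^ (p ^ e))" 1] L(3) by (simp add: emb_def)
    ultimately have "to_fract (z ^ (p ^ e)) = (\<Sum>j\<in>T. to_fract (j ^ Q) * L (s j ^ Q))"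
      by simp
    then have "to_fract (d * z ^ (p ^ e)) =
        (\<Sum>j\<in>T. to_fract (j ^ Q) * (to_fract d * L (s j ^ Q)))"
      by (simp add: sum_distrib_left mult.left_commute)
    also have "\<dots> = to_fract (\<Sum>j\<in>T. c j * j ^ Q)"
      by (simp add: c mult.commute)
    finally have "d * z ^ (p ^ e) = (\<Sum>j\<in>T. c j * j ^ Q)"
      by (simp only: to_fract_eq_iff)
    also have "\<dots> \<in> frobenius_power p (k + e) J"
      unfolding frobenius_power_def ideal_gen_def Q_def
      using T(2) by (intro module.span_sum[OF module_ring_mult]
          module.span_scale[OF module_ring_mult] module.span_base[OF module_ring_mult]) auto
    finally show ?thesis .
  qed
  with d(1) show ?thesis by blast
qed


section \<open>Consequences of strong F-regularity\<close>

lemma strongly_F_regular_tightly_closed: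
  fixes z :: "'a::idom"
  assumes p: "prime p" "CHAR('a) = p" and sfr: "strongly_F_regular p TYPE('a)"
    and I: "ring_ideal I"
    and d: "d \<noteq> 0" "\<And>e. d * z ^ (p ^ e) \<in> frobenius_power p e I"
  shows "z \<in> I"
proof -
  from sfr have "\<exists>e>0. \<exists>\<phi> :: 'a fract alg_closure \<Rightarrow> 'a.
      (\<forall>x\<in>range (pe_root p e). \<forall>y\<in>range (pe_root p e). \<phi> (x + y) = \<phi> x + \<phi> y) \<and>
      (\<forall>r. \<forall>x\<in>range (pe_root p e). \<phi> (emb r * x) = r * \<phi> x) \<and> \<phi> (pe_root p e d) = 1"
    unfolding strongly_F_regular_def using d(1) by (elim allE impE)
  then obtain e and \<phi> :: "'a fract alg_closure \<Rightarrow> 'a" where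
    \<phi>: "\<forall>x\<in>range (pe_root p e). \<forall>y\<in>range (pe_root p e). \<phi> (x + y) = \<phi> x + \<phi> y"
       "\<forall>r. \<forall>x\<in>range (pe_root p e). \<phi> (emb r * x) = r * \<phi> x"
    and one: "\<phi> (pe_root p e d) = 1"
    by (elim exE conjE)
  have add: "\<phi> (pe_root p e r + pe_root p e s) = \<phi> (pe_root p e r) + \<phi> (pe_root p e s)" for r s
    using \<phi>(1) by simp
  have scale: "\<phi> (emb c * pe_root p e r) = c * \<phi> (pe_root p e r)" for c r
    using \<phi>(2) by simp
  \<comment> \<open>The map \<open>\<phi>\<close> carries \<open>I R\<^bsup>1/q\<^esup>\<close>, which consists of the \<open>q\<close>-th roots of \<open>I\<^bsup>[q]\<^esup>\<close>, into \<open>I\<close>.\<close>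
  have "\<phi> (pe_root p e y) \<in> I" if "y \<in> frobenius_power p e I" for y
    using that unfolding frobenius_power_def ideal_gen_def
  proof (induction rule: module.span_induct_alt[OF module_ring_mult, consumes 1, case_names base step])
    case base
    show ?case using scale[of 0 0] I by (simp add: pe_root_0[OF p] ring_ideal_iff)
  next
    case (step c u y)
    then obtain x where x: "x \<in> I" "u = x ^ (p ^ e)" by blast
    have "\<phi> (pe_root p e (c * u + y)) = \<phi> (pe_root p e (x ^ (p ^ e) * c + y))"
      by (simp add: x(2) mult.commute)
    also have "\<dots> = \<phi> (pe_root p e (x ^ (p ^ e) * c)) + \<phi> (pe_root p e y)"
      by (simp only: pe_root_add[OF p] add)
    also have "\<phi> (pe_root p e (x ^ (p ^ e) * c)) = x * \<phi> (pe_root p e c)"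
      by (simp only: pe_root_mult_power[OF p] scale)
    also have "\<dots> = \<phi> (pe_root p e c) * x"
      by (rule mult.commute)
    finally have eq: "\<phi> (pe_root p e (c * u + y)) =
      \<phi> (pe_root p e c) * x + \<phi> (pe_root p e y)" .
    have "\<phi> (pe_root p e c) * x \<in> I"
      using I x(1) unfolding ring_ideal_iff by blast
    with step(2) I show ?case unfolding eq ring_ideal_iff by blast
  qed
  from this[OF d(2)] have "\<phi> (pe_root p e (z ^ (p ^ e) * d)) \<in> I"
    by (simp only: mult.commute)
  then show ?thesis
    by (simp add: pe_root_mult_power[OF p] scale one)
qed

lemma root_in_expansion_iff:
  fixes f :: "'a::idom"
  assumes p: "prime p" "CHAR('a) = p" and sfr: "strongly_F_regular p TYPE('a)"
  shows "pe_root p e f ^ a \<in> ideal_expansion J \<longleftrightarrow> f ^ a \<in> frobenius_power p e J"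
proof
  assume "pe_root p e f ^ a \<in> ideal_expansion J"
  moreover have "(pe_root p e f ^ a) ^ (p ^ e) = emb (f ^ a)"
    using pe_root_power[OF p, of e "f ^ a"] by (simp add: power_pe_root[OF p])
  ultimately obtain d where d: "d \<noteq> 0"
    "\<And>i. d * (f ^ a) ^ (p ^ i) \<in> frobenius_power p (e + i) J"
    using expansion_root_almost_in_frobenius_powers[OF p] by blast
  have "d * (f ^ a) ^ (p ^ i) \<in> frobenius_power p i (frobenius_power p e J)" for i
    using d(2) frobenius_power_iterate by (rule subsetD[rotated])
  with d(1) show "f ^ a \<in> frobenius_power p e J"
    by (rule strongly_F_regular_tightly_closed[OF p sfr ring_ideal_frobenius_power])
next
  assume "f ^ a \<in> frobenius_power p e J"
  from pe_root_in_expansion[OF p this] show "pe_root p e f ^ a \<in> ideal_expansion J"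
    by (simp only: power_pe_root[OF p])
qed

text \<open>
  Bringing two exponents to the common denominator \<open>p^(e+i)\<close> turns their comparison into one
  between powers of \<open>f\<close>, where membership in the ideal \<open>J\<^bsup>[p^(e+i)]\<^esup>\<close> is visibly monotone.
\<close>

lemma root_in_expansion_mono:
  fixes f :: "'a::idom"
  assumes p: "prime p" "CHAR('a) = p" and sfr: "strongly_F_regular p TYPE('a)"
    and a: "pe_root p e f ^ a \<in> ideal_expansion J"
    and le: "real a / real (p ^ e) \<le> real b / real (p ^ i)"
  shows "pe_root p i f ^ b \<in> ideal_expansion J"
proof -
  have "real a * real (p ^ i) \<le> real b * real (p ^ e)"
    using le p(1) by (simp add: field_simps prime_gt_0_nat)
  then have le': "p ^ i * a \<le> p ^ e * b"
    by (simp only: of_nat_mult[symmetric] of_nat_le_iff mult.commute)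
  have "pe_root p (e + i) f ^ (p ^ i * a) \<in> ideal_expansion J"
    using a by (simp add: power_mult pe_root_rescale[OF p])
  then have "f ^ (p ^ i * a) \<in> frobenius_power p (e + i) J"
    by (simp only: root_in_expansion_iff[OF p sfr])
  then have "f ^ (p ^ e * b) \<in> frobenius_power p (e + i) J"
    by (rule power_mono_in_ideal[OF ring_ideal_frobenius_power _ le'])
  then have "pe_root p (i + e) f ^ (p ^ e * b) \<in> ideal_expansion J"
    by (simp only: root_in_expansion_iff[OF p sfr] add.commute)
  then show ?thesis
    by (simp add: power_mult pe_root_rescale[OF p])
qed

lemma finite_powers_outside_frobenius_power:
  assumes "f \<in> ideal_radical J"
  shows "finite {n. f ^ n \<notin> frobenius_power p e J}"
proof -
  obtain m where "f ^ m \<in> J" using assms unfolding ideal_radical_def by blast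
  then have "f ^ (m * p ^ e) \<in> frobenius_power p e J"
    using power_in_frobenius_power[of "f ^ m" J p e] by (simp add: power_mult)
  then have "f ^ n \<in> frobenius_power p e J" if "m * p ^ e \<le> n" for n
    using that by (rule power_mono_in_ideal[OF ring_ideal_frobenius_power])
  then have "{n. f ^ n \<notin> frobenius_power p e J} \<subseteq> {..<m * p ^ e}"
    using leI by blast
  then show ?thesis by (rule finite_subset) simp
qed


section \<open>The F-threshold as a cut\<close>

theorem proposition2p4:
  fixes p :: nat and J :: "'a::idom set" and f :: 'a
  assumes "prime p" and "CHAR('a) = p"
    and "noetherian TYPE('a)"
    and "F_finite p TYPE('a)"
    and "strongly_F_regular p TYPE('a)"
    and "ring_ideal J"
    and "f \<in> ideal_radical J"
  shows "F_threshold p J f =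
           Inf {real a / real (p ^ e) | a e. pe_root p e f ^ a \<in> ideal_expansion J} \<and>
         Inf {real a / real (p ^ e) | a e. pe_root p e f ^ a \<in> ideal_expansion J} =
           Sup0 {real a / real (p ^ e) | a e. pe_root p e f ^ a \<notin> ideal_expansion J}"
proof -
  note p = assms(1,2)
  note iff = root_in_expansion_iff[OF p assms(5)]
  define S where "S = {real a / real (p ^ e) | a e. pe_root p e f ^ a \<in> ideal_expansion J}"
  define T where "T = {real a / real (p ^ e) | a e. pe_root p e f ^ a \<notin> ideal_expansion J}"
  define \<nu> where "\<nu> = nu p J f"
  have bdd: "bdd_below S" by (rule bdd_belowI[of _ 0]) (auto simp: S_def)
  have T_le_S: "t \<le> s" if "t \<in> T" "s \<in> S" for s t
  proof -
    from that(1) obtain b i where t: "t = real b / real (p ^ i)"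
      "pe_root p i f ^ b \<notin> ideal_expansion J" unfolding T_def by blast
    from that(2) obtain a e where s: "s = real a / real (p ^ e)"
      "pe_root p e f ^ a \<in> ideal_expansion J" unfolding S_def by blast
    have "\<not> s \<le> t"
      using root_in_expansion_mono[OF p assms(5) s(2), of b i] t s(1) by blast
    then show ?thesis by simp
  qed
  have Suc_nu: "real (Suc (\<nu> e)) / real (p ^ e) \<in> S" for e
  proof -
    have "Suc (\<nu> e) \<notin> {n. f ^ n \<notin> frobenius_power p e J}"
    proof
      assume *: "Suc (\<nu> e) \<in> {n. f ^ n \<notin> frobenius_power p e J}"
      then have "\<nu> e = Max {n. f ^ n \<notin> frobenius_power p e J}"
        unfolding \<nu>_def nu_def Let_def by (metis empty_iff)
      with Max_ge[OF finite_powers_outside_frobenius_power[OF assms(7)] *] show False by simp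
    qed
    then have "f ^ Suc (\<nu> e) \<in> frobenius_power p e J" by blast
    then show ?thesis unfolding S_def iff by blast
  qed
  have lim: "(\<lambda>e. real (\<nu> e) / real (p ^ e)) \<longlonglongrightarrow> Inf S \<and> Inf S = Sup0 T"
  proof (cases "T = {}")
    case True
    \<comment> \<open>Here \<open>J R\<^sup>+ = R\<^sup>+\<close>, so every \<open>\<nu>\<^sub>e\<close> vanishes by the convention on maxima.\<close>
    then have all: "pe_root p e f ^ a \<in> ideal_expansion J" for a e
      unfolding T_def by blast
    have "\<nu> e = 0" for e
      using all by (simp add: \<nu>_def nu_def iff)
    moreover have "Inf S = 0"
    proof (rule cInf_eq_minimum)
      show "0 \<in> S" using all[of 0 0] unfolding S_def by force
    qed (auto simp: S_def)
    ultimately show ?thesis using True by (simp add: Sup0_def)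
  next
    case False
    have le_Inf: "t \<le> Inf S" if "t \<in> T" for t
      using Suc_nu T_le_S[OF that] by (intro cInf_greatest) auto
    have bddT: "bdd_above T" using le_Inf by (rule bdd_aboveI)
    have nu_in_T: "real (\<nu> e) / real (p ^ e) \<in> T" for e
    proof -
      obtain a i where a: "pe_root p i f ^ a \<notin> ideal_expansion J"
        using False unfolding T_def by blast
      have "pe_root p e f ^ 0 \<notin> ideal_expansion J"
        using a root_in_expansion_mono[OF p assms(5), of e f 0 J a i] by auto
      then have ne: "{n. f ^ n \<notin> frobenius_power p e J} \<noteq> {}"
        unfolding iff by blast
      then have "\<nu> e = Max {n. f ^ n \<notin> frobenius_power p e J}"
        unfolding \<nu>_def nu_def Let_def by (simp only: if_False)
      with Max_in[OF finite_powers_outside_frobenius_power[OF assms(7)] ne]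
      have "f ^ \<nu> e \<notin> frobenius_power p e J" by simp
      then show ?thesis unfolding T_def iff by blast
    qed
    have Sup_le: "Sup T \<le> Inf S"
      using False le_Inf by (intro cSup_least) auto
    have lower: "real (\<nu> e) / real (p ^ e) \<le> Sup T" for e
      using nu_in_T bddT by (rule cSup_upper)
    have upper: "Inf S - 1 / real (p ^ e) \<le> real (\<nu> e) / real (p ^ e)" for e
      using cInf_lower[OF Suc_nu[of e] bdd] by (simp add: field_simps add_divide_distrib)
    have "(\<lambda>e. (1 / real p) ^ e) \<longlonglongrightarrow> 0"
      using prime_gt_1_nat[OF p(1)] by (intro LIMSEQ_realpow_zero) auto
    then have "(\<lambda>e. Inf S - 1 / real (p ^ e)) \<longlonglongrightarrow> Inf S - 0"
      by (intro tendsto_intros) (simp add: power_one_over)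
    then have gap: "(\<lambda>e. Inf S - 1 / real (p ^ e)) \<longlonglongrightarrow> Inf S" by simp
    have "Inf S \<le> Sup T"
      by (rule LIMSEQ_le_const2[OF gap]) (meson upper lower order_trans)
    with Sup_le have eq: "Inf S = Sup T" by simp
    have "(\<lambda>e. real (\<nu> e) / real (p ^ e)) \<longlonglongrightarrow> Inf S"
      by (rule tendsto_sandwich[OF _ _ gap tendsto_const]) (use upper lower eq in auto)
    with eq False show ?thesis by (simp add: Sup0_def)
  qed
  then have "F_threshold p J f = Inf S"
    unfolding F_threshold_def \<nu>_def by (blast intro: limI)
  with lim show ?thesis unfolding S_def T_def by blast
qed

end
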